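(* Let $(B,\bm{A}^\top)^\top$ be a random vector with $B\in\{-1,1\}$ and $\bm{A}\in\{-1,1\}^p$, and let $(B_i,\bm{A}_i)$, $i=1,\dots,n$, be i.i.d. copies of $(B,\bm{A})$. Let $\hat{\bm{\beta}}_{MP}=(\mathcal{A}^\top\mathcal{A})^{+}\mathcal{A}^\top\mathcal{B}$ and $\hat{\bm{\beta}}=(\mathcal{A}^\top\mathcal{A})^{-1}\mathcal{A}^\top\mathcal{B}$, the latter existing only when $\mathcal{A}^\top\mathcal{A}$ is invertible. Let $S=\{\hat{\bm{\beta}}_{MP}=\hat{\bm{\beta}}\}$, that is, the event that $\hat{\bm{\beta}}$ exists, and suppose $\mathbf{P}(S)>0$. If the vector $\bm{\beta}\in\mathbb{R}^{2^p}$ with $\mathbf{E}[B\mid\bm{A}]=\bm{\beta}^\top\bm{A}^{\otimes}$ is uniquely defined, then $\mathbf{E}[\hat{\bm{\beta}}_{MP}\mid S]=\bm{\beta}$, and $\hat{\bm{\beta}}_{MP}$ maximizes the likelihood function of $\bm{\beta}$ for the distribution of $(B,\bm{A}^\top)^\top$.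
   Context: For $\bm{A}\in\{-1,1\}^p$, $\bm{A}^{\otimes}=\begin{pmatrix}1\\ A_1\end{pmatrix}\otimes\cdots\otimes\begin{pmatrix}1\\ A_p\end{pmatrix}\in\{-1,1\}^{2^p}$. $\mathcal{B}=(B_1,\dots,B_n)^\top$, and $\mathcal{A}$ is the $n\times 2^p$ matrix with rows $\bm{A}_1^{\otimes\top},\dots,\bm{A}_n^{\otimes\top}$. $M^{+}$ denotes the Moore--Penrose pseudoinverse. $\mathbf{H}_{2^p}$ is the Sylvester Hadamard matrix ($\mathbf{H}_1=(1)$, $\mathbf{H}_{2m}=\begin{pmatrix}\mathbf{H}_m&\mathbf{H}_m\\ \mathbf{H}_m&-\mathbf{H}_m\end{pmatrix}$), whose rows are the $2^p$ possible values of $\bm{A}^{\otimes}$. The vector $\bm{\beta}$ is uniquely defined exactly when $\mathbf{P}(\bm{A}^{\otimes}=\bm{v})>0$ for all rows $\bm{v}$ of $\mathbf{H}_{2^p}$. The joint distribution of $(B,\bm{A})$ is parametrized by the vector of probabilities $\mathbf{P}(\bm{A}^{\otimes}=\bm{v})$ and by $\bm{\beta}$ ranging over $\{\bm{b}:\|\mathbf{H}_{2^p}\bm{b}\|_\infty\le1\}$, via $\mathbf{P}(B=r\mid\bm{A}^{\otimes}=\bm{v})=(1+r\bm{\beta}^\top\bm{v})/2$, $r=\pm1$; the likelihood is that of the i.i.d. sample. *)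

theory Defs
  imports
    "HOL-Probability.Probability"
    "Jordan_Normal_Form.Gauss_Jordan_Elimination"
begin

unbundle no vec_syntax
hide_type (open) Finite_Cartesian_Product.vec
hide_const (open) Finite_Cartesian_Product.vec Finite_Cartesian_Product.transpose

definition sign_vecs :: "nat \<Rightarrow> real vec set" where
  "sign_vecs p = {a \<in> carrier_vec p. \<forall>j<p. a $ j \<in> {-1, 1}}"

definition kron_vec :: "real vec \<Rightarrow> real vec \<Rightarrow> real vec" where
  "kron_vec u v = vec (dim_vec u * dim_vec v)
     (\<lambda>i. u $ (i div dim_vec v) * v $ (i mod dim_vec v))"

text \<open>\<open>tensor_vec a\<close> is \<open>a\<^sup>\<otimes>\<close>; the empty product is the vector \<open>(1)\<close>, which is
  neutral for \<^const>\<open>kron_vec\<close>.\<close>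

definition tensor_vec :: "real vec \<Rightarrow> real vec" where
  "tensor_vec a = foldr (\<lambda>x v. kron_vec (vec_of_list [1, x]) v) (list_of_vec a) (vec_of_list [1])"

fun sylvester :: "nat \<Rightarrow> real mat" where
  "sylvester 0 = 1\<^sub>m 1"
| "sylvester (Suc p) =
     four_block_mat (sylvester p) (sylvester p) (sylvester p) (- sylvester p)"

definition linf_norm :: "real vec \<Rightarrow> real" where
  "linf_norm v = Max ((\<lambda>i. \<bar>v $ i\<bar>) ` {..<dim_vec v})"

text \<open>The four Penrose equations; over the reals the adjoint is the transpose.\<close>

definition is_pseudoinverse :: "real mat \<Rightarrow> real mat \<Rightarrow> bool" where
  "is_pseudoinverse M X \<longleftrightarrow>
     X \<in> carrier_mat (dim_col M) (dim_row M) \<and>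
     M * X * M = M \<and> X * M * X = X \<and>
     transpose_mat (M * X) = M * X \<and> transpose_mat (X * M) = X * M"

definition pseudoinverse :: "real mat \<Rightarrow> real mat" where
  "pseudoinverse M = (THE X. is_pseudoinverse M X)"

text \<open>A sample of size \<open>n\<close> is given by \<open>b i\<close> and \<open>a i\<close> for \<open>i < n\<close>.\<close>

definition design_mat :: "nat \<Rightarrow> nat \<Rightarrow> (nat \<Rightarrow> real vec) \<Rightarrow> real mat" where
  "design_mat n p a = mat_of_rows (2 ^ p) (map (\<lambda>i. tensor_vec (a i)) [0..<n])"

definition gram_mat :: "nat \<Rightarrow> nat \<Rightarrow> (nat \<Rightarrow> real vec) \<Rightarrow> real mat" where
  "gram_mat n p a = transpose_mat (design_mat n p a) * design_mat n p a"

definition beta_MP :: "nat \<Rightarrow> nat \<Rightarrow> (nat \<Rightarrow> real) \<Rightarrow> (nat \<Rightarrow> real vec) \<Rightarrow> real vec" where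
  "beta_MP n p b a =
     pseudoinverse (gram_mat n p a) *\<^sub>v (transpose_mat (design_mat n p a) *\<^sub>v vec n b)"

text \<open>\<^const>\<open>mat_inverse\<close> returns \<^const>\<open>None\<close> on singular matrices, so the ordinary estimator
  is \<^const>\<open>None\<close> exactly when it does not exist.\<close>

definition beta_LS ::
  "nat \<Rightarrow> nat \<Rightarrow> (nat \<Rightarrow> real) \<Rightarrow> (nat \<Rightarrow> real vec) \<Rightarrow> real vec option" where
  "beta_LS n p b a =
     map_option (\<lambda>G. G *\<^sub>v (transpose_mat (design_mat n p a) *\<^sub>v vec n b))
       (mat_inverse (gram_mat n p a))"

text \<open>\<open>E[B | A] = \<beta>\<^sup>T A\<^sup>\<otimes>\<close> almost surely, the conditional expectation being taken given the
  \<open>\<sigma>\<close>-algebra generated by \<open>A\<close>.\<close>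

definition regression_vec ::
  "'a measure \<Rightarrow> nat \<Rightarrow> ('a \<Rightarrow> real) \<Rightarrow> ('a \<Rightarrow> real vec) \<Rightarrow> real vec \<Rightarrow> bool" where
  "regression_vec M p B A \<beta> \<longleftrightarrow>
     \<beta> \<in> carrier_vec (2 ^ p) \<and>
     (AE \<omega> in M. real_cond_exp M (vimage_algebra (space M) A (count_space (sign_vecs p))) B \<omega>
        = scalar_prod \<beta> (tensor_vec (A \<omega>)))"

text \<open>The model is parametrized by \<open>q v = P(A\<^sup>\<otimes> = v)\<close>, for \<open>v\<close> a row of the Hadamard matrix,
  and by the vector \<open>\<beta>\<close>.\<close>

definition row_probs :: "nat \<Rightarrow> (real vec \<Rightarrow> real) set" where
  "row_probs p = {q. (\<forall>v \<in> set (rows (sylvester p)). 0 \<le> q v) \<and>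
                     (\<Sum>v \<in> set (rows (sylvester p)). q v) = 1}"

definition beta_space :: "nat \<Rightarrow> real vec set" where
  "beta_space p = {\<beta> \<in> carrier_vec (2 ^ p). linf_norm (sylvester p *\<^sub>v \<beta>) \<le> 1}"

definition model_pmf ::
  "(real vec \<Rightarrow> real) \<Rightarrow> real vec \<Rightarrow> real \<Rightarrow> real vec \<Rightarrow> real" where
  "model_pmf q \<beta> r a = q (tensor_vec a) * ((1 + r * scalar_prod \<beta> (tensor_vec a)) / 2)"

definition likelihood ::
  "nat \<Rightarrow> (nat \<Rightarrow> real) \<Rightarrow> (nat \<Rightarrow> real vec) \<Rightarrow> (real vec \<Rightarrow> real) \<Rightarrow> real vec \<Rightarrow> real" where
  "likelihood n b a q \<beta> = (\<Prod>i<n. model_pmf q \<beta> (b i) (a i))"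

lemma pseudoinverse_invertible:
  assumes M: "M \<in> carrier_mat m m" and G: "mat_inverse M = Some G"
  shows "pseudoinverse M = G"
proof -
  have inv: "M * G = 1\<^sub>m m" "G * M = 1\<^sub>m m" "G \<in> carrier_mat m m"
    using mat_inverse(2)[OF M G] by auto
  show ?thesis unfolding pseudoinverse_def
  proof (rule the_equality)
    show "is_pseudoinverse M G"
      using M inv by (auto simp: is_pseudoinverse_def)
  next
    fix X assume X: "is_pseudoinverse M X"
    hence Xc: "X \<in> carrier_mat m m" and e: "M * X * M = M"
      using M by (auto simp: is_pseudoinverse_def)
    have MXc: "M * X \<in> carrier_mat m m" using M Xc by simp
    have "M * X = M * X * (M * G)" using right_mult_one_mat[OF MXc] inv(1) by simp
    also have "\<dots> = M * X * M * G" using M inv(3) MXc by (simp add: assoc_mult_mat)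
    finally have MX: "M * X = 1\<^sub>m m" using e inv by simp
    have "X = G * M * X" using inv Xc by simp
    also have "\<dots> = G * (M * X)" using M inv(3) Xc by (simp add: assoc_mult_mat)
    finally show "X = G" using MX inv(3) by simp
  qed
qed

text \<open>The event that the two estimators coincide is the event that \<^const>\<open>beta_LS\<close> exists.\<close>

lemma beta_LS_eq_beta_MP_iff:
  "beta_LS n p b a = Some (beta_MP n p b a) \<longleftrightarrow> beta_LS n p b a \<noteq> None"
proof -
  have "gram_mat n p a \<in> carrier_mat (2 ^ p) (2 ^ p)"
    by (auto simp: gram_mat_def design_mat_def)
  from pseudoinverse_invertible[OF this] show ?thesis
    by (cases "mat_inverse (gram_mat n p a)") (auto simp: beta_LS_def beta_MP_def)
qed

end

theory Submission
  imports Defs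
begin

text \<open>The vectors \<open>a\<^sup>\<otimes>\<close> are pairwise orthogonal, so the Gram matrix
  \<open>\<Sum>\<^sub>v N\<^sub>v v v\<^sup>T\<close> is diagonal in the basis they form, and its pseudoinverse merely inverts the nonzero
  weights. Hence the fitted value of the estimator at \<open>v\<close> is the mean of the responses observed
  there, and \<open>0\<close> if there are none. The likelihood factorizes over the \<open>v\<close>, and each
  factor is maximal at that mean. As for unbiasedness, given the covariates the estimator is linear
  in the responses, and it maps the vector of conditional means back to \<open>\<beta>\<close> as soon as the
  Gram matrix is invertible, which is an event in the covariates alone.\<close>

unbundle no inner_syntax

section \<open>Tensor products of signs and the rows of the Sylvester matrix\<close>

text \<open>Lists of signs let the tensor factors be peeled off by induction;
  \<open>tensor_vec\<close> is the same fold applied to \<open>list_of_vec\<close>.\<close>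

definition tensor_list :: "real list \<Rightarrow> real vec" where
  "tensor_list xs = foldr (\<lambda>x v. kron_vec (vec_of_list [1, x]) v) xs (vec_of_list [1])"

lemma tensor_list_Nil: "tensor_list [] = vec_of_list [1]"
  by (simp add: tensor_list_def)

text \<open>The quotient of an index by \<open>dim_vec v\<close> is 0 in the upper half and 1 in the
  lower half. The stacked form matches the block recursion of \<open>sylvester\<close>.\<close>

lemma kron_vec_pair: "kron_vec (vec_of_list [1, x]) v = v @\<^sub>v x \<cdot>\<^sub>v v"
proof (cases "dim_vec v = 0")
  case True
  then show ?thesis by (auto simp: kron_vec_def)
next
  case False
  show ?thesis
  proof (rule eq_vecI)
    fix i assume "i < dim_vec (v @\<^sub>v x \<cdot>\<^sub>v v)"
    then have i: "i < dim_vec v + dim_vec v" by simp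
    show "kron_vec (vec_of_list [1, x]) v $ i = (v @\<^sub>v x \<cdot>\<^sub>v v) $ i"
    proof (cases "i < dim_vec v")
      case True
      then show ?thesis by (simp add: kron_vec_def)
    next
      case False
      with i have "i div dim_vec v = 1" "i mod dim_vec v = i - dim_vec v"
        by (simp_all add: div_nat_eqI le_mod_geq)
      then show ?thesis using False i by (simp add: kron_vec_def)
    qed
  qed (simp add: kron_vec_def)
qed

lemma tensor_list_Cons: "tensor_list (x # xs) = tensor_list xs @\<^sub>v x \<cdot>\<^sub>v tensor_list xs"
  by (simp add: tensor_list_def kron_vec_pair del: vec_of_list_Cons)

lemma tensor_list_carrier: "tensor_list xs \<in> carrier_vec (2 ^ length xs)"
proof (induction xs)
  case (Cons x xs)
  have "x \<cdot>\<^sub>v tensor_list xs \<in> carrier_vec (2 ^ length xs)" using Cons by simp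
  from append_carrier_vec[OF Cons this]
  show ?case unfolding tensor_list_Cons by (simp only: list.size power_Suc mult_2 add_0_right add_Suc_right)
qed (simp add: tensor_list_Nil)

text \<open>Each pair of leading signs contributes a factor \<open>1 + x * y\<close>, which is 2 if
  they agree and 0 if they differ.\<close>

lemma scalar_prod_tensor_list:
  assumes "length xs = length ys" "set xs \<subseteq> {-1, 1}" "set ys \<subseteq> {-1, 1}"
  shows "tensor_list xs \<bullet> tensor_list ys = (if xs = ys then 2 ^ length xs else 0)"
  using assms
proof (induction xs ys rule: list_induct2)
  case Nil
  then show ?case by (simp add: tensor_list_Nil scalar_prod_def)
next
  case (Cons x xs y ys)
  note c = tensor_list_carrier[of xs] tensor_list_carrier[of ys, folded Cons.hyps]
  have "tensor_list (x # xs) \<bullet> tensor_list (y # ys) = (1 + x * y) * (tensor_list xs \<bullet> tensor_list ys)"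
    using c by (simp add: tensor_list_Cons scalar_prod_append[of _ "2 ^ length xs" _ "2 ^ length xs"] algebra_simps)
  then show ?case using Cons by auto
qed

text \<open>The upper blocks prefix the sign 1 to the list behind a row, the lower blocks the sign
  -1. The dimensions are carried through the induction because the block decomposition of the rows
  depends on them.\<close>

lemma rows_sylvester_tensor:
  "set (rows (sylvester p)) = tensor_list ` {xs. length xs = p \<and> set xs \<subseteq> {-1, 1}}
   \<and> sylvester p \<in> carrier_mat (2 ^ p) (2 ^ p)"
proof (induction p)
  case 0
  have "row (1\<^sub>m 1) 0 = vec_of_list [1::real]"
    by (rule eq_vecI) auto
  then show ?case by (auto simp: tensor_list_Nil rows_def)
next
  case (Suc p)
  let ?H = "sylvester p" and ?L = "\<lambda>p. {xs::real list. length xs = p \<and> set xs \<subseteq> {-1, 1}}"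
  from Suc have H: "?H \<in> carrier_mat (2 ^ p) (2 ^ p)"
    and R: "set (rows ?H) = tensor_list ` ?L p" by auto
  have rows_set: "set (rows M) = row M ` {..<dim_row M}" for M :: "real mat"
    by (auto simp: rows_def)
  have top: "row (sylvester (Suc p)) i = row ?H i @\<^sub>v row ?H i" if "i < 2 ^ p" for i
    using row_four_block_mat(1)[OF H H H uminus_carrier_mat[OF H] that] by simp
  have bot: "row (sylvester (Suc p)) i = row ?H (i - 2 ^ p) @\<^sub>v - row ?H (i - 2 ^ p)"
    if "i \<ge> 2 ^ p" "i < 2 ^ p + 2 ^ p" for i
    using row_four_block_mat(2)[OF H H H uminus_carrier_mat[OF H], of i] that H by simp
  have u: "1 \<cdot>\<^sub>v v = v" "-1 \<cdot>\<^sub>v v = - v" for v :: "real vec"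
    by (rule eq_vecI; simp)+
  have c: "sylvester (Suc p) \<in> carrier_mat (2 ^ Suc p) (2 ^ Suc p)"
    using H by (auto simp flip: mult_2)
  have "{..<2 ^ p + 2 ^ p} = {..<2 ^ p} \<union> {2 ^ p..<2 ^ p + 2 ^ p :: nat}" by auto
  also have "{2 ^ p..<2 ^ p + 2 ^ p} = (\<lambda>i. i + 2 ^ p) ` {..<2 ^ p :: nat}"
    by (simp only: lessThan_atLeast0 image_add_atLeastLessThan' add_0_left)
  finally have split: "{..<2 ^ Suc p} = {..<2 ^ p} \<union> (\<lambda>i. i + 2 ^ p) ` {..<2 ^ p :: nat}"
    by (simp only: power_Suc mult_2)
  have "set (rows (sylvester (Suc p)))
      = (\<lambda>v. v @\<^sub>v v) ` set (rows ?H) \<union> (\<lambda>v. v @\<^sub>v - v) ` set (rows ?H)"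
    unfolding rows_set carrier_matD(1)[OF c] carrier_matD(1)[OF H] split image_Un image_image
    by (intro arg_cong2[where f="(\<union>)"] image_cong refl) (simp_all add: top bot del: sylvester.simps)
  also have "\<dots> = (\<Union>xs\<in>?L p. {tensor_list (1 # xs), tensor_list (-1 # xs)})"
    unfolding R tensor_list_Cons u by auto
  also have "\<dots> = tensor_list ` (\<Union>xs\<in>?L p. {1 # xs, -1 # xs})"
    by auto
  also have "(\<Union>xs\<in>?L p. {1 # xs, -1 # xs}) = ?L (Suc p)"
    by (auto simp: length_Suc_conv)
  finally show ?case using c by simp
qed

lemma list_of_sign_vec:
  "list_of_vec ` sign_vecs p = {xs. length xs = p \<and> set xs \<subseteq> {-1, 1}}" (is "_ = ?L")
proof
  show "list_of_vec ` sign_vecs p \<subseteq> ?L"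
    by (auto simp: sign_vecs_def set_list_of_vec vec_set_def)
  show "?L \<subseteq> list_of_vec ` sign_vecs p"
  proof
    fix xs assume xs: "xs \<in> ?L"
    have "xs ! j \<in> {-1, 1}" if "j < p" for j
      using xs that nth_mem[of j xs] by blast
    then have "vec_of_list xs \<in> sign_vecs p"
      using xs unfolding sign_vecs_def carrier_vec_def mem_Collect_eq vec_of_list_index dim_vec_of_list
      by blast
    then show "xs \<in> list_of_vec ` sign_vecs p"
      by (metis image_eqI list_vec)
  qed
qed

lemma finite_sign_vecs: "finite (sign_vecs p)"
proof -
  have "inj list_of_vec" by (metis injI vec_list)
  moreover have "finite (list_of_vec ` sign_vecs p)"
    unfolding list_of_sign_vec using finite_lists_length_eq[of "{-1, 1::real}" p]
    by (simp add: conj_commute)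
  ultimately show ?thesis by (metis finite_imageD inj_on_subset subset_UNIV)
qed

lemma tensor_vec_alt: "tensor_vec a = tensor_list (list_of_vec a)"
  by (simp add: tensor_vec_def tensor_list_def)

lemma tensor_vec_carrier: "a \<in> sign_vecs p \<Longrightarrow> tensor_vec a \<in> carrier_vec (2 ^ p)"
  using tensor_list_carrier[of "list_of_vec a"]
  by (auto simp: tensor_vec_alt sign_vecs_def)

lemma rows_sylvester: "set (rows (sylvester p)) = tensor_vec ` sign_vecs p"
  unfolding tensor_vec_alt image_image[of tensor_list list_of_vec, symmetric] list_of_sign_vec
  using rows_sylvester_tensor by blast

lemma scalar_prod_tensor_vec:
  assumes "a \<in> sign_vecs p" "a' \<in> sign_vecs p"
  shows "tensor_vec a \<bullet> tensor_vec a' = (if a = a' then 2 ^ p else 0)"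
proof -
  have "list_of_vec a \<in> list_of_vec ` sign_vecs p" "list_of_vec a' \<in> list_of_vec ` sign_vecs p"
    using assms by auto
  then have "length (list_of_vec a) = p" "length (list_of_vec a') = p"
    "set (list_of_vec a) \<subseteq> {-1, 1}" "set (list_of_vec a') \<subseteq> {-1, 1}"
    unfolding list_of_sign_vec by auto
  moreover have "list_of_vec a = list_of_vec a' \<longleftrightarrow> a = a'" by (metis vec_list)
  ultimately show ?thesis unfolding tensor_vec_alt
    by (subst scalar_prod_tensor_list) auto
qed

section \<open>Uniqueness of the Moore-Penrose pseudoinverse\<close>

text \<open>Transposing \<open>M * Y = (M * X) * (M * Y)\<close> swaps the two symmetric factors,
  which yields \<open>M * Y = M * X\<close>; likewise \<open>Y * M = X * M\<close>. Then
  \<open>X = X * M * X = Y * M * X = Y * M * Y = Y\<close>.\<close>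

lemma is_pseudoinverse_unique:
  assumes X: "is_pseudoinverse M X" and Y: "is_pseudoinverse M Y"
  shows "X = Y"
proof -
  obtain r c where M: "M \<in> carrier_mat r c" by blast
  have Xc: "X \<in> carrier_mat c r" and Yc: "Y \<in> carrier_mat c r"
    using X Y M by (auto simp: is_pseudoinverse_def)
  have MX: "M * X \<in> carrier_mat r r" and MY: "M * Y \<in> carrier_mat r r"
    and XM: "X * M \<in> carrier_mat c c" and YM: "Y * M \<in> carrier_mat c c"
    using M Xc Yc by auto
  have "M * Y = (M * X * M) * Y" using X by (simp add: is_pseudoinverse_def)
  also have "\<dots> = (M * X) * (M * Y)" using assoc_mult_mat[OF MX M Yc] by simp
  finally have "transpose_mat (M * Y) = transpose_mat ((M * X) * (M * Y))" by simp
  then have "M * Y = (M * Y) * (M * X)"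
    using X Y transpose_mult[OF MX MY] by (simp add: is_pseudoinverse_def)
  also have "\<dots> = (M * Y * M) * X" using assoc_mult_mat[OF MY M Xc] by simp
  finally have 1: "M * Y = M * X" using Y by (simp add: is_pseudoinverse_def)
  have "Y * M = Y * (M * X * M)" using X by (simp add: is_pseudoinverse_def)
  also have "\<dots> = (Y * M) * (X * M)"
    using assoc_mult_mat[OF Yc M XM] assoc_mult_mat[OF M Xc M] by simp
  finally have "transpose_mat (Y * M) = transpose_mat ((Y * M) * (X * M))" by simp
  then have "Y * M = (X * M) * (Y * M)"
    using X Y transpose_mult[OF YM XM] by (simp add: is_pseudoinverse_def)
  also have "\<dots> = X * (M * Y * M)"
    using assoc_mult_mat[OF Xc M YM] assoc_mult_mat[OF M Yc M] by simp
  finally have 2: "Y * M = X * M" using Y by (simp add: is_pseudoinverse_def)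
  have "X = X * M * X" using X by (simp add: is_pseudoinverse_def)
  also have "\<dots> = Y * (M * X)" using assoc_mult_mat[OF Yc M Xc] 2 by simp
  also have "\<dots> = Y * M * Y" using assoc_mult_mat[OF Yc M Yc] 1 by simp
  also have "\<dots> = Y" using Y by (simp add: is_pseudoinverse_def)
  finally show ?thesis .
qed

lemma pseudoinverse_eqI: "is_pseudoinverse M X \<Longrightarrow> pseudoinverse M = X"
  unfolding pseudoinverse_def by (blast intro: the_equality is_pseudoinverse_unique)


section \<open>Vectors and matrices expanded in the orthogonal tensor basis\<close>

text \<open>A Parseval identity: after exchanging the sums only scalar products of basis vectors
  remain, and those with \<open>v = w\<close> survive. The multiplication rules for
  \<open>tensor_frame\<close> and \<open>tensor_comb\<close> reduce to it.\<close>

lemma sum_tensor_orthogonal: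
  "(\<Sum>k<2 ^ p. (\<Sum>w\<in>sign_vecs p. x w * tensor_vec w $ k) * (\<Sum>v\<in>sign_vecs p. y v * tensor_vec v $ k))
    = 2 ^ p * (\<Sum>w\<in>sign_vecs p. x w * y w)" (is "?L = _")
proof -
  let ?V = "sign_vecs p"
  have "?L = (\<Sum>k<2 ^ p. \<Sum>w\<in>?V. \<Sum>v\<in>?V. x w * y v * (tensor_vec w $ k * tensor_vec v $ k))"
    unfolding sum_product by (intro sum.cong refl) (simp add: mult_ac)
  also have "\<dots> = (\<Sum>w\<in>?V. \<Sum>k<2 ^ p. \<Sum>v\<in>?V. x w * y v * (tensor_vec w $ k * tensor_vec v $ k))"
    by (rule sum.swap)
  also have "\<dots> = (\<Sum>w\<in>?V. \<Sum>v\<in>?V. \<Sum>k<2 ^ p. x w * y v * (tensor_vec w $ k * tensor_vec v $ k))"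
    by (intro sum.cong refl) (rule sum.swap)
  also have "\<dots> = (\<Sum>w\<in>?V. \<Sum>v\<in>?V. x w * y v * (tensor_vec w \<bullet> tensor_vec v))"
    by (intro sum.cong refl)
      (simp add: scalar_prod_def sum_distrib_left carrier_vecD[OF tensor_vec_carrier] lessThan_atLeast0)
  also have "\<dots> = (\<Sum>w\<in>?V. \<Sum>v\<in>?V. if v = w then 2 ^ p * (x w * y w) else 0)"
    by (intro sum.cong refl) (simp add: scalar_prod_tensor_vec)
  also have "\<dots> = (\<Sum>w\<in>?V. 2 ^ p * (x w * y w))"
    by (simp add: finite_sign_vecs)
  finally show ?thesis by (simp add: sum_distrib_left)
qed

definition tensor_comb :: "nat \<Rightarrow> (real vec \<Rightarrow> real) \<Rightarrow> real vec" where
  "tensor_comb p s = vec (2 ^ p) (\<lambda>k. \<Sum>v\<in>sign_vecs p. s v * tensor_vec v $ k)"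

text \<open>A weighted sum of rank-one matrices: for a sign vector \<open>v\<close>,
  \<open>tensor_vec v\<close> is an eigenvector with eigenvalue \<open>2 ^ p * c v\<close>.\<close>

definition tensor_frame :: "nat \<Rightarrow> (real vec \<Rightarrow> real) \<Rightarrow> real mat" where
  "tensor_frame p c =
     mat (2 ^ p) (2 ^ p) (\<lambda>(j, k). \<Sum>v\<in>sign_vecs p. c v * tensor_vec v $ j * tensor_vec v $ k)"

lemma tensor_frame_carrier: "tensor_frame p c \<in> carrier_mat (2 ^ p) (2 ^ p)"
  by (simp add: tensor_frame_def)

lemma transpose_tensor_frame: "transpose_mat (tensor_frame p c) = tensor_frame p c"
  by (rule eq_matI) (auto simp: tensor_frame_def mult_ac intro!: sum.cong)

lemma tensor_frame_mult:
  "tensor_frame p c * tensor_frame p d = tensor_frame p (\<lambda>v. 2 ^ p * c v * d v)"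
proof (rule eq_matI)
  fix j l assume "j < dim_row (tensor_frame p (\<lambda>v. 2 ^ p * c v * d v))"
    "l < dim_col (tensor_frame p (\<lambda>v. 2 ^ p * c v * d v))"
  then have jl: "j < 2 ^ p" "l < 2 ^ p" by (auto simp: tensor_frame_def)
  have "(tensor_frame p c * tensor_frame p d) $$ (j, l) =
      (\<Sum>k<2 ^ p. (\<Sum>w\<in>sign_vecs p. (c w * tensor_vec w $ j) * tensor_vec w $ k) *
        (\<Sum>v\<in>sign_vecs p. (d v * tensor_vec v $ l) * tensor_vec v $ k))"
    using jl by (simp add: tensor_frame_def scalar_prod_def lessThan_atLeast0 mult_ac)
  also have "\<dots> = tensor_frame p (\<lambda>v. 2 ^ p * c v * d v) $$ (j, l)"
    unfolding sum_tensor_orthogonal unfolding sum_distrib_left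
    using jl by (auto simp: tensor_frame_def intro!: sum.cong)
  finally show "(tensor_frame p c * tensor_frame p d) $$ (j, l) =
      tensor_frame p (\<lambda>v. 2 ^ p * c v * d v) $$ (j, l)" .
qed (simp_all add: tensor_frame_def)

lemma tensor_frame_comb:
  "tensor_frame p c *\<^sub>v tensor_comb p s = tensor_comb p (\<lambda>v. 2 ^ p * c v * s v)"
proof (rule eq_vecI)
  fix j assume "j < dim_vec (tensor_comb p (\<lambda>v. 2 ^ p * c v * s v))"
  then have j: "j < 2 ^ p" by (auto simp: tensor_comb_def)
  have "(tensor_frame p c *\<^sub>v tensor_comb p s) $ j =
      (\<Sum>k<2 ^ p. (\<Sum>w\<in>sign_vecs p. (c w * tensor_vec w $ j) * tensor_vec w $ k) *
        (\<Sum>v\<in>sign_vecs p. s v * tensor_vec v $ k))"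
    using j by (simp add: tensor_frame_def tensor_comb_def scalar_prod_def lessThan_atLeast0)
  also have "\<dots> = tensor_comb p (\<lambda>v. 2 ^ p * c v * s v) $ j"
    unfolding sum_tensor_orthogonal unfolding sum_distrib_left
    using j by (auto simp: tensor_comb_def intro!: sum.cong)
  finally show "(tensor_frame p c *\<^sub>v tensor_comb p s) $ j = tensor_comb p (\<lambda>v. 2 ^ p * c v * s v) $ j" .
qed (simp_all add: tensor_frame_def tensor_comb_def)

lemma scalar_prod_tensor_comb:
  assumes "a \<in> sign_vecs p"
  shows "tensor_vec a \<bullet> tensor_comb p s = 2 ^ p * s a"
proof -
  \<comment> \<open>The coefficients \<open>of_bool (w = a)\<close> expand
    \<open>tensor_vec a\<close> itself in the basis, which gives the claim the shape of
    \<open>sum_tensor_orthogonal\<close>.\<close>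
  have *: "(\<Sum>w\<in>sign_vecs p. of_bool (w = a) * f w) = f a" for f :: "real vec \<Rightarrow> real"
  proof -
    have "(\<Sum>w\<in>sign_vecs p. of_bool (w = a) * f w) = (\<Sum>w\<in>sign_vecs p. if w = a then f w else 0)"
      by (intro sum.cong) auto
    then show ?thesis using assms by (simp add: finite_sign_vecs)
  qed
  have "tensor_vec a \<bullet> tensor_comb p s = (\<Sum>k<2 ^ p.
      (\<Sum>w\<in>sign_vecs p. of_bool (w = a) * tensor_vec w $ k) * (\<Sum>v\<in>sign_vecs p. s v * tensor_vec v $ k))"
    unfolding * by (simp add: scalar_prod_def tensor_comb_def lessThan_atLeast0)
  also have "\<dots> = 2 ^ p * (\<Sum>w\<in>sign_vecs p. of_bool (w = a) * s w)"
    by (rule sum_tensor_orthogonal)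
  finally show ?thesis unfolding * .
qed

text \<open>The eigenvalue \<open>2 ^ p * c v\<close> must turn into its reciprocal, which is
  \<open>2 ^ p * (inverse (c v) / 4 ^ p)\<close>. The convention \<open>inverse 0 = 0\<close> sends
  directions of weight 0 to 0, as the Penrose equations demand.\<close>

lemma pseudoinverse_tensor_frame:
  "pseudoinverse (tensor_frame p c) = tensor_frame p (\<lambda>v. inverse (c v) / 4 ^ p)"
proof (rule pseudoinverse_eqI)
  have four: "(4::real) ^ p = 2 ^ p * 2 ^ p"
    by (simp flip: power_mult_distrib)
  show "is_pseudoinverse (tensor_frame p c) (tensor_frame p (\<lambda>v. inverse (c v) / 4 ^ p))"
    unfolding is_pseudoinverse_def tensor_frame_mult transpose_tensor_frame
    by (auto simp: tensor_frame_def four field_simps intro!: eq_matI sum.cong)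
qed

section \<open>Observations grouped by covariate value, and the estimator in terms of cell
  means\<close>

definition cell :: "nat \<Rightarrow> (nat \<Rightarrow> real vec) \<Rightarrow> real vec \<Rightarrow> nat set" where
  "cell n a v = {i \<in> {..<n}. a i = v}"

text \<open>On an empty cell the quotient is \<open>0 / 0 = 0\<close>, in agreement with the weight
  0 that the pseudoinverse gives to unobserved covariate values.\<close>

definition cell_mean :: "nat \<Rightarrow> (nat \<Rightarrow> real) \<Rightarrow> (nat \<Rightarrow> real vec) \<Rightarrow> real vec \<Rightarrow> real" where
  "cell_mean n b a v = (\<Sum>i\<in>cell n a v. b i) / card (cell n a v)"

lemma design_mat_carrier: "design_mat n p a \<in> carrier_mat n (2 ^ p)"
  by (rule carrier_matI) (simp_all add: design_mat_def)

lemma design_mat_index: "i < n \<Longrightarrow> j < 2 ^ p \<Longrightarrow> a i \<in> sign_vecs p \<Longrightarrow>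
    design_mat n p a $$ (i, j) = tensor_vec (a i) $ j"
  by (simp add: design_mat_def mat_of_rows_index)

lemma gram_mat_eq_tensor_frame:
  assumes a: "\<forall>i<n. a i \<in> sign_vecs p"
  shows "gram_mat n p a = tensor_frame p (\<lambda>v. card (cell n a v))"
proof (rule eq_matI)
  fix j k assume "j < dim_row (tensor_frame p (\<lambda>v. card (cell n a v)))"
    "k < dim_col (tensor_frame p (\<lambda>v. card (cell n a v)))"
  then have jk: "j < 2 ^ p" "k < 2 ^ p" by (auto simp: tensor_frame_def)
  have "gram_mat n p a $$ (j, k) = (\<Sum>i<n. tensor_vec (a i) $ j * tensor_vec (a i) $ k)"
    using jk a design_mat_carrier[of n p a]
    by (simp add: gram_mat_def scalar_prod_def design_mat_index lessThan_atLeast0)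
  also have "\<dots> = (\<Sum>v\<in>sign_vecs p. \<Sum>i\<in>cell n a v. tensor_vec (a i) $ j * tensor_vec (a i) $ k)"
    unfolding cell_def using a by (subst sum.group) (auto simp: finite_sign_vecs)
  also have "\<dots> = (\<Sum>v\<in>sign_vecs p. card (cell n a v) * tensor_vec v $ j * tensor_vec v $ k)"
    by (intro sum.cong refl) (simp add: cell_def)
  finally show "gram_mat n p a $$ (j, k) = tensor_frame p (\<lambda>v. card (cell n a v)) $$ (j, k)"
    using jk by (simp add: tensor_frame_def)
qed (auto simp: gram_mat_def tensor_frame_def design_mat_def)

lemma transpose_design_mult:
  assumes a: "\<forall>i<n. a i \<in> sign_vecs p"
  shows "transpose_mat (design_mat n p a) *\<^sub>v vec n b = tensor_comb p (\<lambda>v. \<Sum>i\<in>cell n a v. b i)"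
proof (rule eq_vecI)
  fix k assume "k < dim_vec (tensor_comb p (\<lambda>v. \<Sum>i\<in>cell n a v. b i))"
  then have k: "k < 2 ^ p" by (auto simp: tensor_comb_def)
  have "(transpose_mat (design_mat n p a) *\<^sub>v vec n b) $ k = (\<Sum>i<n. b i * tensor_vec (a i) $ k)"
    using k a design_mat_carrier[of n p a]
    by (simp add: scalar_prod_def design_mat_index lessThan_atLeast0 mult_ac)
  also have "\<dots> = (\<Sum>v\<in>sign_vecs p. \<Sum>i\<in>cell n a v. b i * tensor_vec (a i) $ k)"
    unfolding cell_def using a by (subst sum.group) (auto simp: finite_sign_vecs)
  also have "\<dots> = (\<Sum>v\<in>sign_vecs p. (\<Sum>i\<in>cell n a v. b i) * tensor_vec v $ k)"
    unfolding sum_distrib_right by (intro sum.cong refl) (simp add: cell_def)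
  finally show "(transpose_mat (design_mat n p a) *\<^sub>v vec n b) $ k =
      tensor_comb p (\<lambda>v. \<Sum>i\<in>cell n a v. b i) $ k"
    using k by (simp add: tensor_comb_def)
qed (auto simp: tensor_comb_def design_mat_def)

text \<open>The pseudoinverse divides the cell sums by the cell sizes; of its denominator
  \<open>4 ^ p\<close>, one factor \<open>2 ^ p\<close> cancels against the squared length of the
  basis vectors.\<close>

lemma beta_MP_eq_tensor_comb:
  assumes a: "\<forall>i<n. a i \<in> sign_vecs p"
  shows "beta_MP n p b a = tensor_comb p (\<lambda>v. cell_mean n b a v / 2 ^ p)"
proof -
  have four: "(4::real) ^ p = 2 ^ p * 2 ^ p"
    by (simp flip: power_mult_distrib)
  show ?thesis
    unfolding beta_MP_def transpose_design_mult[OF a] gram_mat_eq_tensor_frame[OF a]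
      pseudoinverse_tensor_frame tensor_frame_comb
    by (rule arg_cong[where f="tensor_comb p"], rule ext) (simp add: four cell_mean_def field_simps)
qed

lemma fitted_value:
  assumes "\<forall>i<n. a i \<in> sign_vecs p" "v \<in> sign_vecs p"
  shows "tensor_vec v \<bullet> beta_MP n p b a = cell_mean n b a v"
  using assms by (simp add: beta_MP_eq_tensor_comb scalar_prod_tensor_comb)

section \<open>Maximization of the likelihood\<close>

text \<open>The rows of \<open>sylvester p\<close> are the tensor vectors, so the norm constraint
  bounds the fitted value at each sign vector.\<close>

lemma beta_space_iff:
  "\<beta> \<in> beta_space p \<longleftrightarrow> \<beta> \<in> carrier_vec (2 ^ p) \<and> (\<forall>v\<in>sign_vecs p. \<bar>tensor_vec v \<bullet> \<beta>\<bar> \<le> 1)"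
proof -
  have c: "sylvester p \<in> carrier_mat (2 ^ p) (2 ^ p)" using rows_sylvester_tensor by blast
  have r: "row (sylvester p) ` {..<2 ^ p} = tensor_vec ` sign_vecs p"
    using c unfolding rows_sylvester[symmetric] by (auto simp: rows_def)
  have ne: "sign_vecs p \<noteq> {}" using r by (auto simp: lessThan_empty_iff)
  have "linf_norm (sylvester p *\<^sub>v \<beta>) = Max ((\<lambda>v. \<bar>v \<bullet> \<beta>\<bar>) ` row (sylvester p) ` {..<2 ^ p})"
    using c unfolding linf_norm_def image_image by (intro arg_cong[where f=Max] image_cong) auto
  then have "linf_norm (sylvester p *\<^sub>v \<beta>) \<le> 1 \<longleftrightarrow> (\<forall>v\<in>sign_vecs p. \<bar>tensor_vec v \<bullet> \<beta>\<bar> \<le> 1)"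
    unfolding r using ne by (simp add: finite_sign_vecs)
  then show ?thesis by (simp add: beta_space_def)
qed

text \<open>With \<open>x\<^sub>i = (1 + b\<^sub>i t) / (1 + b\<^sub>i y)\<close> one has \<open>\<Sum> x\<^sub>i = card I\<close> unless \<open>b\<close> is constant, so
  \<open>\<Prod> x\<^sub>i \<le> \<Prod> exp (x\<^sub>i - 1) = 1\<close>.\<close>

lemma prod_sign_le_prod_mean:
  fixes b :: "'i \<Rightarrow> real"
  assumes I: "finite I" and b: "\<forall>i\<in>I. b i \<in> {-1, 1}" and t: "\<bar>t\<bar> \<le> 1"
  defines "y \<equiv> (\<Sum>i\<in>I. b i) / card I"
  shows "(\<Prod>i\<in>I. 1 + b i * t) \<le> (\<Prod>i\<in>I. 1 + b i * y)"
proof (cases "\<exists>s\<in>{-1, 1}. \<forall>i\<in>I. b i = s")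
  \<comment> \<open>If \<open>I\<close> is nonempty, the mean equals the common sign and every
    factor on the right takes the maximal value 2; if \<open>I\<close> is empty, both products are
    1.\<close>
  case True
  then obtain s where s: "s \<in> {-1, 1}" "\<And>i. i \<in> I \<Longrightarrow> b i = s" by blast
  show ?thesis
  proof (rule prod_mono)
    fix i assume i: "i \<in> I"
    then have "card I > 0" using I by (auto simp: card_gt_0_iff)
    then have "y = s" using s by (simp add: y_def)
    then show "0 \<le> 1 + b i * t \<and> 1 + b i * t \<le> 1 + b i * y" using s i t by auto
  qed
next
  case False
  then obtain i j where ij: "i \<in> I" "j \<in> I" "b i = 1" "b j = -1" using b by blast
  define N where "N = real (card I)"
  have N: "N > 0" using I ij by (auto simp: N_def card_gt_0_iff)
  have Ny: "(\<Sum>i\<in>I. b i) = N * y" using N by (simp add: y_def N_def)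
  \<comment> \<open>Both signs occur, so the mean lies strictly between -1 and 1 and no denominator
    vanishes.\<close>
  have "(\<Sum>i\<in>I. 1 - b i) > 0" "(\<Sum>i\<in>I. 1 + b i) > 0"
    using ij b I by (force intro!: sum_pos2)+
  then have "N * (1 - y) > 0" "N * (1 + y) > 0"
    by (auto simp: sum_subtractf sum.distrib Ny algebra_simps N_def)
  then have y: "-1 < y" "y < 1" using N by (auto simp: zero_less_mult_iff)
  have pos: "1 + b i * y > 0" if "i \<in> I" for i using b[rule_format, OF that] y by auto
  have y2: "1 - y\<^sup>2 > 0" using y by (simp add: abs_square_less_1)
  let ?x = "\<lambda>i. (1 + b i * t) / (1 + b i * y)"
  \<comment> \<open>Expanding the fraction by \<open>1 - b i * y\<close>, where \<open>b i\<close>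
    squares to 1, makes it affine in \<open>b i\<close>, so the sum depends on the signs only
    through their total.\<close>
  have x: "?x i = (1 - t * y + b i * (t - y)) / (1 - y\<^sup>2)" if "i \<in> I" for i
    using b[rule_format, OF that] pos[OF that] y2 by (auto simp: field_simps power2_eq_square)
  have "(\<Sum>i\<in>I. ?x i) = (\<Sum>i\<in>I. 1 - t * y + b i * (t - y)) / (1 - y\<^sup>2)"
    unfolding sum_divide_distrib by (intro sum.cong refl x)
  also have "(\<Sum>i\<in>I. 1 - t * y + b i * (t - y)) = N * (1 - y\<^sup>2)"
    unfolding sum.distrib sum_distrib_right[symmetric] Ny
    by (simp add: N_def[symmetric] algebra_simps power2_eq_square)
  finally have sum: "(\<Sum>i\<in>I. ?x i - 1) = 0"
    using y2 by (simp add: sum_subtractf N_def)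
  have "(\<Prod>i\<in>I. ?x i) \<le> (\<Prod>i\<in>I. exp (?x i - 1))"
  proof (rule prod_mono)
    fix i assume i: "i \<in> I"
    have "0 \<le> 1 + b i * t" using b[rule_format, OF i] t by auto
    then show "0 \<le> ?x i \<and> ?x i \<le> exp (?x i - 1)"
      using pos[OF i] exp_ge_add_one_self[of "?x i - 1"] by auto
  qed
  also have "\<dots> = 1" unfolding exp_sum[OF I, symmetric] sum by simp
  finally have "(\<Prod>i\<in>I. 1 + b i * t) / (\<Prod>i\<in>I. 1 + b i * y) \<le> 1"
    by (simp add: prod_dividef)
  moreover have "(\<Prod>i\<in>I. 1 + b i * y) > 0" by (intro prod_pos) (simp add: pos)
  ultimately show ?thesis by simp
qed

lemma abs_cell_mean_le:
  assumes "\<forall>i<n. b i \<in> {-1, 1::real}"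
  shows "\<bar>cell_mean n b a v\<bar> \<le> 1"
proof -
  have "\<bar>\<Sum>i\<in>cell n a v. b i\<bar> \<le> (\<Sum>i\<in>cell n a v. \<bar>b i\<bar>)" by (rule sum_abs)
  also have "\<dots> = (\<Sum>i\<in>cell n a v. 1)"
    using assms by (intro sum.cong) (auto simp: cell_def)
  finally show ?thesis by (auto simp: cell_mean_def divide_le_eq_1)
qed

text \<open>Fitted values are means of signs, or 0, so the estimator is an admissible
  parameter.\<close>

lemma beta_MP_in_beta_space:
  assumes a: "\<forall>i<n. a i \<in> sign_vecs p" and b: "\<forall>i<n. b i \<in> {-1, 1}"
  shows "beta_MP n p b a \<in> beta_space p"
  unfolding beta_space_iff
  using fitted_value[OF a, of _ b] abs_cell_mean_le[OF b]
  by (auto simp: beta_MP_eq_tensor_comb[OF a] tensor_comb_def)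

text \<open>The factors coming from \<open>q\<close> are nonnegative and free of the parameter. In
  each cell the fitted value of the estimator is the mean to which
  \<open>prod_sign_le_prod_mean\<close> refers.\<close>

lemma likelihood_le_beta_MP:
  assumes a: "\<forall>i<n. a i \<in> sign_vecs p" and b: "\<forall>i<n. b i \<in> {-1, 1}"
    and q: "q \<in> row_probs p" and \<beta>: "\<beta> \<in> beta_space p"
  shows "likelihood n b a q \<beta> \<le> likelihood n b a q (beta_MP n p b a)"
proof -
  have L: "likelihood n b a q \<gamma> = (\<Prod>i<n. q (tensor_vec (a i)) / 2) *
      (\<Prod>v\<in>sign_vecs p. \<Prod>i\<in>cell n a v. 1 + b i * (tensor_vec v \<bullet> \<gamma>))"
    if "\<gamma> \<in> beta_space p" for \<gamma>
  proof -
    have "likelihood n b a q \<gamma> = (\<Prod>i<n. q (tensor_vec (a i)) / 2) *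
      (\<Prod>i<n. 1 + b i * (tensor_vec (a i) \<bullet> \<gamma>))"
      unfolding likelihood_def model_pmf_def prod.distrib[symmetric]
      using that a tensor_vec_carrier
      by (intro prod.cong refl) (auto simp: beta_space_iff comm_scalar_prod[of \<gamma> "2 ^ p"])
    also have "(\<Prod>i<n. 1 + b i * (tensor_vec (a i) \<bullet> \<gamma>)) =
        (\<Prod>v\<in>sign_vecs p. \<Prod>i\<in>cell n a v. 1 + b i * (tensor_vec (a i) \<bullet> \<gamma>))"
      unfolding cell_def using a by (subst prod.group) (auto simp: finite_sign_vecs)
    also have "\<dots> = (\<Prod>v\<in>sign_vecs p. \<Prod>i\<in>cell n a v. 1 + b i * (tensor_vec v \<bullet> \<gamma>))"
      by (intro prod.cong refl) (simp add: cell_def)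
    finally show ?thesis .
  qed
  have bc: "\<forall>i\<in>cell n a v. b i \<in> {-1, 1}" for v
    using b by (simp add: cell_def)
  have fin: "finite (cell n a v)" for v by (simp add: cell_def)
  have q0: "0 \<le> (\<Prod>i<n. q (tensor_vec (a i)) / 2)"
    using q a by (intro prod_nonneg) (auto simp: row_probs_def rows_sylvester)
  have "(\<Prod>v\<in>sign_vecs p. \<Prod>i\<in>cell n a v. 1 + b i * (tensor_vec v \<bullet> \<beta>))
      \<le> (\<Prod>v\<in>sign_vecs p. \<Prod>i\<in>cell n a v. 1 + b i * (tensor_vec v \<bullet> beta_MP n p b a))"
  proof (rule prod_mono, rule conjI)
    fix v assume v: "v \<in> sign_vecs p"
    then have t: "\<bar>tensor_vec v \<bullet> \<beta>\<bar> \<le> 1" using \<beta> by (simp add: beta_space_iff)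
    \<comment> \<open>Monotonicity of products needs nonnegative factors, which the constraint on
      \<beta> supplies.\<close>
    show "0 \<le> (\<Prod>i\<in>cell n a v. 1 + b i * (tensor_vec v \<bullet> \<beta>))"
      using bc t by (intro prod_nonneg) force
    show "(\<Prod>i\<in>cell n a v. 1 + b i * (tensor_vec v \<bullet> \<beta>))
        \<le> (\<Prod>i\<in>cell n a v. 1 + b i * (tensor_vec v \<bullet> beta_MP n p b a))"
      unfolding fitted_value[OF a v] cell_mean_def
      by (rule prod_sign_le_prod_mean[OF fin bc t])
  qed
  then show ?thesis
    unfolding L[OF \<beta>] L[OF beta_MP_in_beta_space[OF a b]] by (rule mult_left_mono[OF _ q0])
qed


section \<open>The estimator as a linear function of the responses\<close>

text \<open>The coefficients of the responses involve the covariates alone and become constants once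
  a covariate configuration is fixed.\<close>

lemma beta_MP_index:
  assumes a: "\<forall>i<n. a i \<in> sign_vecs p" and j: "j < 2 ^ p"
  shows "beta_MP n p b a $ j =
    (\<Sum>i<n. (pseudoinverse (gram_mat n p a) * transpose_mat (design_mat n p a)) $$ (j, i) * b i)"
proof -
  let ?D = "transpose_mat (design_mat n p a)" and ?P = "pseudoinverse (gram_mat n p a)"
  have D: "?D \<in> carrier_mat (2 ^ p) n" using design_mat_carrier by simp
  have P: "?P \<in> carrier_mat (2 ^ p) (2 ^ p)"
    unfolding gram_mat_eq_tensor_frame[OF a] pseudoinverse_tensor_frame by (rule tensor_frame_carrier)
  have PD: "?P * ?D \<in> carrier_mat (2 ^ p) n" using P D by (rule mult_carrier_mat)
  have "beta_MP n p b a = (?P * ?D) *\<^sub>v vec n b"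
    unfolding beta_MP_def by (rule assoc_mult_mat_vec[OF P D, symmetric]) simp
  moreover have "(Q *\<^sub>v vec n b) $ j = (\<Sum>i<n. Q $$ (j, i) * b i)"
    if "Q \<in> carrier_mat (2 ^ p) n" for Q
    using that j by (auto simp: scalar_prod_def lessThan_atLeast0 intro!: sum.cong)
  ultimately show ?thesis using PD by metis
qed

text \<open>With conditional means as responses, the response vector is
  \<open>design_mat n p a *\<^sub>v \<beta>\<close>, and the inverse of the Gram matrix cancels the
  Gram matrix.\<close>

lemma beta_MP_reproduces:
  assumes a: "\<forall>i<n. a i \<in> sign_vecs p"
    and inv: "mat_inverse (gram_mat n p a) \<noteq> None" and \<beta>: "\<beta> \<in> carrier_vec (2 ^ p)"
  shows "beta_MP n p (\<lambda>i. \<beta> \<bullet> tensor_vec (a i)) a = \<beta>"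
proof -
  let ?X = "design_mat n p a"
  have X: "?X \<in> carrier_mat n (2 ^ p)" by (rule design_mat_carrier)
  then have XT: "transpose_mat ?X \<in> carrier_mat (2 ^ p) n" by simp
  obtain G where G: "mat_inverse (gram_mat n p a) = Some G" using inv by blast
  have gram: "gram_mat n p a \<in> carrier_mat (2 ^ p) (2 ^ p)"
    using X by (simp add: gram_mat_def)
  have GM: "G * gram_mat n p a = 1\<^sub>m (2 ^ p)" "G \<in> carrier_mat (2 ^ p) (2 ^ p)"
    using mat_inverse(2)[OF gram G] by auto
  have fit: "vec n (\<lambda>i. \<beta> \<bullet> tensor_vec (a i)) = ?X *\<^sub>v \<beta>"
  proof (rule eq_vecI)
    fix i assume "i < dim_vec (?X *\<^sub>v \<beta>)"
    then have i: "i < n" using X by simp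
    have "row ?X i = tensor_vec (a i)"
      using i a tensor_vec_carrier by (simp add: design_mat_def)
    then show "vec n (\<lambda>i. \<beta> \<bullet> tensor_vec (a i)) $ i = (?X *\<^sub>v \<beta>) $ i"
      using i X comm_scalar_prod[OF \<beta> tensor_vec_carrier[OF a[rule_format, OF i]]] by simp
  qed (use X in simp)
  have "beta_MP n p (\<lambda>i. \<beta> \<bullet> tensor_vec (a i)) a = G *\<^sub>v (transpose_mat ?X *\<^sub>v (?X *\<^sub>v \<beta>))"
    unfolding beta_MP_def pseudoinverse_invertible[OF gram G] fit ..
  also have "\<dots> = G *\<^sub>v (gram_mat n p a *\<^sub>v \<beta>)"
    unfolding gram_mat_def assoc_mult_mat_vec[OF XT X \<beta>] ..
  also have "\<dots> = (G * gram_mat n p a) *\<^sub>v \<beta>"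
    by (rule assoc_mult_mat_vec[OF GM(2) gram \<beta>, symmetric])
  finally show ?thesis using GM(1) \<beta> by simp
qed

text \<open>Passing to the restriction lets covariate configurations range over a finite set of
  extensional functions.\<close>

lemma design_mat_restrict: "design_mat n p (restrict a {..<n}) = design_mat n p a"
  unfolding design_mat_def by (intro arg_cong[where f="mat_of_rows _"] map_cong) auto

lemma beta_MP_restrict: "beta_MP n p b (restrict a {..<n}) = beta_MP n p b a"
  by (simp add: beta_MP_def gram_mat_def design_mat_restrict)

section \<open>Moments of the i.i.d. sample\<close>

text \<open>The event \<open>A = v\<close> belongs to the sigma-algebra generated by
  \<open>A\<close>, so \<open>B\<close> and its conditional expectation have the same integral over
  it, and there the latter is almost surely constant.\<close>

lemma (in prob_space) regression_vec_expectation: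
  assumes B: "B \<in> M \<rightarrow>\<^sub>M count_space {-1, 1}"
    and A: "A \<in> M \<rightarrow>\<^sub>M count_space (sign_vecs p)"
    and reg: "regression_vec M p B A \<beta>" and v: "v \<in> sign_vecs p"
  shows "expectation (\<lambda>\<omega>. B \<omega> * of_bool (A \<omega> = v)) =
    (\<beta> \<bullet> tensor_vec v) * expectation (\<lambda>\<omega>. of_bool (A \<omega> = v))"
proof -
  define F where "F = vimage_algebra (space M) A (count_space (sign_vecs p))"
  define C where "C = A -` {v} \<inter> space M"
  have CF: "C \<in> sets F" unfolding F_def C_def using v by (intro in_vimage_algebra) auto
  have "sets F \<subseteq> sets M" unfolding F_def by (rule sets_image_in_sets[OF refl A])
  then have sub: "subalgebra M F" by (simp add: subalgebra_def F_def)
  interpret finite_measure_subalgebra M F by unfold_locales (rule sub)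
  have C: "C \<in> sets M" using CF \<open>sets F \<subseteq> sets M\<close> by blast
  have Bm: "B \<in> borel_measurable M"
    by (rule measurable_compose[OF B]) simp
  have "B \<omega> \<in> {-1, 1}" if "\<omega> \<in> space M" for \<omega>
    using measurable_space[OF B that] by simp
  then have Bint: "integrable M B"
    by (intro integrable_const_bound[of _ 1] AE_I2 Bm) force
  have reg': "AE \<omega> in M. real_cond_exp M F B \<omega> = \<beta> \<bullet> tensor_vec (A \<omega>)"
    using reg by (simp add: regression_vec_def F_def)
  have "expectation (\<lambda>\<omega>. B \<omega> * of_bool (A \<omega> = v)) = (\<integral>\<omega>\<in>C. B \<omega> \<partial>M)"
    unfolding set_lebesgue_integral_def
    by (intro Bochner_Integration.integral_cong) (auto simp: C_def)
  also have "\<dots> = (\<integral>\<omega>\<in>C. real_cond_exp M F B \<omega> \<partial>M)"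
    by (rule real_cond_exp_intA[OF Bint CF])
  also have "\<dots> = (\<integral>\<omega>. (\<beta> \<bullet> tensor_vec v) * indicator C \<omega> \<partial>M)"
    unfolding set_lebesgue_integral_def using C reg'
    by (intro integral_cong_AE) (auto simp: C_def split: split_indicator)
  also have "\<dots> = (\<integral>\<omega>. (\<beta> \<bullet> tensor_vec v) * of_bool (A \<omega> = v) \<partial>M)"
    by (intro Bochner_Integration.integral_cong) (auto simp: C_def)
  finally show ?thesis by simp
qed

text \<open>Independence factorizes the expectation, equality in distribution replaces each
  \<open>Z k\<close> by \<open>Y\<close>, and the uniform bound makes the factors
  integrable.\<close>

lemma (in prob_space) iid_expectation_prod:
  fixes g :: "nat \<Rightarrow> 'c \<Rightarrow> real"
  assumes indep: "indep_vars (\<lambda>_. count_space T) Z {..<n}"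
    and dist: "\<And>i. i < n \<Longrightarrow> distr M (count_space T) (Z i) = distr M (count_space T) Y"
    and Y: "Y \<in> M \<rightarrow>\<^sub>M count_space T"
    and bound: "\<And>k z. z \<in> T \<Longrightarrow> \<bar>g k z\<bar> \<le> 1"
  shows "expectation (\<lambda>\<omega>. \<Prod>k<n. g k (Z k \<omega>)) = (\<Prod>k<n. expectation (\<lambda>\<omega>. g k (Y \<omega>)))"
proof -
  have Z: "Z k \<in> M \<rightarrow>\<^sub>M count_space T" if "k < n" for k
    using indep that by (simp add: indep_vars_def2)
  have g: "g k \<in> borel_measurable (count_space T)" for k by simp
  have ind: "indep_vars (\<lambda>_. borel) (\<lambda>k \<omega>. g k (Z k \<omega>)) {..<n}"
    by (rule indep_vars_compose2[OF indep g])
  have int: "integrable M (\<lambda>\<omega>. g k (Z k \<omega>))" if "k < n" for k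
  proof (rule integrable_const_bound[of _ 1])
    show "AE \<omega> in M. norm (g k (Z k \<omega>)) \<le> 1"
      using bound measurable_space[OF Z[OF that]] by (intro AE_I2) simp
  qed (rule measurable_compose[OF Z[OF that] g])
  have "expectation (\<lambda>\<omega>. g k (Z k \<omega>)) = expectation (\<lambda>\<omega>. g k (Y \<omega>))" if "k < n" for k
    using integral_distr[OF Z[OF that] g, of k] integral_distr[OF Y g, of k] dist[OF that] by simp
  then show ?thesis
    using int by (subst indep_vars_lebesgue_integral[OF _ ind]) auto
qed


text \<open>Only the factor at \<open>i\<close> involves a response. Once
  \<open>regression_vec_expectation\<close> has evaluated it, the factors recombine into the
  probability of the whole covariate configuration.\<close>

lemma (in prob_space) sample_moment:
  fixes n :: nat
  assumes B: "B \<in> M \<rightarrow>\<^sub>M count_space {-1, 1}"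
    and A: "A \<in> M \<rightarrow>\<^sub>M count_space (sign_vecs p)"
    and indep: "indep_vars (\<lambda>_. count_space ({-1, 1} \<times> sign_vecs p)) (\<lambda>i \<omega>. (Bs i \<omega>, As i \<omega>)) {..<n}"
    and dist: "\<And>i. i < n \<Longrightarrow>
      distr M (count_space ({-1, 1} \<times> sign_vecs p)) (\<lambda>\<omega>. (Bs i \<omega>, As i \<omega>)) =
      distr M (count_space ({-1, 1} \<times> sign_vecs p)) (\<lambda>\<omega>. (B \<omega>, A \<omega>))"
    and reg: "regression_vec M p B A \<beta>"
    and a: "\<forall>k<n. a k \<in> sign_vecs p" and i: "i < n"
  shows "expectation (\<lambda>\<omega>. Bs i \<omega> * (\<Prod>k<n. of_bool (As k \<omega> = a k))) =
    (\<beta> \<bullet> tensor_vec (a i)) * expectation (\<lambda>\<omega>. \<Prod>k<n. of_bool (As k \<omega> = a k))"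
proof -
  let ?T = "{-1, 1} \<times> sign_vecs p"
  \<comment> \<open>\<open>g k\<close> is the indicator of the covariate value \<open>a k\<close>,
    and \<open>h\<close> adds the response at index \<open>i\<close> only, so one product rule
    serves both sides.\<close>
  define g :: "nat \<Rightarrow> real \<times> real vec \<Rightarrow> real" where "g k z = of_bool (snd z = a k)" for k z
  define h where "h k z = (if k = i then fst z else 1) * g k z" for k z
  have "(\<lambda>\<omega>. (B \<omega>, A \<omega>)) \<in> M \<rightarrow>\<^sub>M count_space {-1, 1} \<Otimes>\<^sub>M count_space (sign_vecs p)"
    using B A by (rule measurable_Pair)
  also have "count_space {-1, 1::real} \<Otimes>\<^sub>M count_space (sign_vecs p) = count_space ?T"
    by (intro pair_measure_countable) (auto simp: countable_finite finite_sign_vecs)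
  finally have Y: "(\<lambda>\<omega>. (B \<omega>, A \<omega>)) \<in> M \<rightarrow>\<^sub>M count_space ?T" .
  note E = iid_expectation_prod[OF indep dist Y]
  have g1: "\<bar>g k z\<bar> \<le> 1" for k z by (simp add: g_def)
  have h1: "\<bar>h k z\<bar> \<le> 1" if "z \<in> ?T" for k z
    using that by (auto simp: h_def g_def)
  have split: "prod f {..<n} = f i * prod f ({..<n} - {i})" for f :: "nat \<Rightarrow> real"
    using i by (intro prod.remove) auto
  have "Bs i \<omega> * (\<Prod>k<n. of_bool (As k \<omega> = a k)) = (\<Prod>k<n. h k (Bs k \<omega>, As k \<omega>))" for \<omega>
    unfolding split h_def g_def by (simp add: mult.assoc)
  then have "expectation (\<lambda>\<omega>. Bs i \<omega> * (\<Prod>k<n. of_bool (As k \<omega> = a k)))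
      = (\<Prod>k<n. expectation (\<lambda>\<omega>. h k (B \<omega>, A \<omega>)))"
    using E[of h] h1 by simp
  also have "\<dots> = expectation (\<lambda>\<omega>. B \<omega> * of_bool (A \<omega> = a i)) *
      (\<Prod>k\<in>{..<n} - {i}. expectation (\<lambda>\<omega>. g k (B \<omega>, A \<omega>)))"
    unfolding split by (simp add: h_def g_def)
  also have "expectation (\<lambda>\<omega>. B \<omega> * of_bool (A \<omega> = a i)) =
      (\<beta> \<bullet> tensor_vec (a i)) * expectation (\<lambda>\<omega>. g i (B \<omega>, A \<omega>))"
    unfolding g_def snd_conv using a i by (intro regression_vec_expectation[OF B A reg]) simp
  also have "\<dots> * (\<Prod>k\<in>{..<n} - {i}. expectation (\<lambda>\<omega>. g k (B \<omega>, A \<omega>))) =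
      (\<beta> \<bullet> tensor_vec (a i)) * (\<Prod>k<n. expectation (\<lambda>\<omega>. g k (B \<omega>, A \<omega>)))"
    unfolding split by (simp add: mult.assoc)
  also have "(\<Prod>k<n. expectation (\<lambda>\<omega>. g k (B \<omega>, A \<omega>))) =
      expectation (\<lambda>\<omega>. \<Prod>k<n. of_bool (As k \<omega> = a k))"
    using E[of g] g1 by (simp add: g_def)
  finally show ?thesis .
qed

text \<open>The product of indicators singles out the restriction of \<open>x\<close>. A function of
  random covariates thereby becomes a finite combination of indicators with constant
  coefficients.\<close>

lemma sum_configurations:
  fixes F :: "(nat \<Rightarrow> 'c) \<Rightarrow> real" and n :: nat
  assumes V: "finite V" and x: "\<forall>i<n. x i \<in> V"
  shows "(\<Sum>a\<in>{..<n} \<rightarrow>\<^sub>E V. (\<Prod>k<n. of_bool (x k = a k)) * F a) = F (restrict x {..<n})"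
proof -
  let ?r = "restrict x {..<n}"
  have r: "?r \<in> {..<n} \<rightarrow>\<^sub>E V" using x by auto
  have "(\<Prod>k<n. of_bool (x k = a k)) = (of_bool (a = ?r) :: real)" if "a \<in> {..<n} \<rightarrow>\<^sub>E V" for a
  proof (cases "a = ?r")
    case False
    with that r obtain k where "k < n" "x k \<noteq> a k" by (metis PiE_ext lessThan_iff restrict_apply')
    then show ?thesis using False by (auto intro!: prod_zero)
  qed auto
  then have "(\<Sum>a\<in>{..<n} \<rightarrow>\<^sub>E V. (\<Prod>k<n. of_bool (x k = a k)) * F a) =
      (\<Sum>a\<in>{..<n} \<rightarrow>\<^sub>E V. if a = ?r then F a else 0)"
    by (intro sum.cong) auto
  then show ?thesis using r V by (simp add: finite_PiE)
qed

section \<open>Unbiasedness given \<open>S\<close>, and the maximum likelihood property\<close>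

theorem theorem3p6:
  fixes M :: "'a measure" and n p :: nat
    and B :: "'a \<Rightarrow> real" and A :: "'a \<Rightarrow> real vec"
    and Bs :: "nat \<Rightarrow> 'a \<Rightarrow> real" and As :: "nat \<Rightarrow> 'a \<Rightarrow> real vec"
    and \<beta> :: "real vec" and S :: "'a set"
  defines "S \<equiv> {\<omega> \<in> space M. beta_LS n p (\<lambda>i. Bs i \<omega>) (\<lambda>i. As i \<omega>)
                            = Some (beta_MP n p (\<lambda>i. Bs i \<omega>) (\<lambda>i. As i \<omega>))}"
  assumes "prob_space M"
    and "B \<in> M \<rightarrow>\<^sub>M count_space {-1, 1}"
    and "A \<in> M \<rightarrow>\<^sub>M count_space (sign_vecs p)"
    and "prob_space.indep_vars M (\<lambda>_. count_space ({-1, 1} \<times> sign_vecs p))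
           (\<lambda>i \<omega>. (Bs i \<omega>, As i \<omega>)) {..<n}"
    and "\<And>i. i < n \<Longrightarrow>
           distr M (count_space ({-1, 1} \<times> sign_vecs p)) (\<lambda>\<omega>. (Bs i \<omega>, As i \<omega>)) =
           distr M (count_space ({-1, 1} \<times> sign_vecs p)) (\<lambda>\<omega>. (B \<omega>, A \<omega>))"
    and "measure M S > 0"
    and "\<exists>!b. regression_vec M p B A b"
    and "regression_vec M p B A \<beta>"
  shows "vec (2 ^ p) (\<lambda>j. \<integral>\<omega>. beta_MP n p (\<lambda>i. Bs i \<omega>) (\<lambda>i. As i \<omega>) $ j \<partial>uniform_measure M S) = \<beta>
    \<and> (\<forall>\<omega> \<in> space M. \<forall>q \<in> row_probs p.
          is_arg_max (likelihood n (\<lambda>i. Bs i \<omega>) (\<lambda>i. As i \<omega>) q) (\<lambda>b. b \<in> beta_space p)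
            (beta_MP n p (\<lambda>i. Bs i \<omega>) (\<lambda>i. As i \<omega>)))"
proof -
  interpret prob_space M by fact
  note B = assms(3) and A = assms(4) and indep = assms(5) and dist = assms(6) and reg = assms(9)
  let ?V = "sign_vecs p"
  define K where "K = ({..<n} \<rightarrow>\<^sub>E ?V)"
  define good where "good a \<longleftrightarrow> mat_inverse (gram_mat n p a) \<noteq> None" for a :: "nat \<Rightarrow> real vec"
  \<comment> \<open>The indicator that the sample shows the covariate configuration
    \<open>a\<close>; for \<open>a\<close> in \<open>K\<close> these events partition the
    space.\<close>
  define e where "e a \<omega> = (\<Prod>k<n. of_bool (As k \<omega> = a k) :: real)"
    for a :: "nat \<Rightarrow> real vec" and \<omega>
  define c where "c a j i =
    (pseudoinverse (gram_mat n p a) * transpose_mat (design_mat n p a)) $$ (j, i)" for a :: "nat \<Rightarrow> real vec" and j i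
  have \<beta>: "\<beta> \<in> carrier_vec (2 ^ p)" using reg by (simp add: regression_vec_def)
  have Z: "(\<lambda>\<omega>. (Bs i \<omega>, As i \<omega>)) \<in> M \<rightarrow>\<^sub>M count_space ({-1, 1} \<times> ?V)" if "i < n" for i
    using indep that by (simp add: indep_vars_def2)
  have Zval: "Bs i \<omega> \<in> {-1, 1}" "As i \<omega> \<in> ?V" if "i < n" "\<omega> \<in> space M" for i \<omega>
    using measurable_space[OF Z that(2)] that(1) by auto
  have K: "finite K" "\<And>a. a \<in> K \<Longrightarrow> \<forall>i<n. a i \<in> ?V"
    unfolding K_def by (auto simp: finite_PiE finite_sign_vecs)
  have conf: "(\<Sum>a\<in>K. e a \<omega> * F a) = F (restrict (\<lambda>i. As i \<omega>) {..<n})" if "\<omega> \<in> space M" for F \<omega>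
    unfolding K_def e_def using Zval(2)[OF _ that] by (intro sum_configurations finite_sign_vecs) auto
  have em [measurable]: "e a \<in> borel_measurable M" for a
    unfolding e_def[abs_def]
  proof (rule borel_measurable_prod)
    fix k assume "k \<in> {..<n}"
    then show "(\<lambda>\<omega>. of_bool (As k \<omega> = a k) :: real) \<in> borel_measurable M"
      using measurable_compose[OF Z, of k "\<lambda>z. of_bool (snd z = a k)" borel] by simp
  qed
  have Bm: "Bs i \<in> borel_measurable M" if "i < n" for i
    using measurable_compose[OF Z[OF that], of fst borel] by simp
  have e01: "\<bar>e a \<omega>\<bar> \<le> 1" for a \<omega>
    unfolding e_def abs_prod by (intro prod_le_1) auto
  have eint: "integrable M (e a)" for a
    using e01 by (intro integrable_const_bound[of _ 1]) auto
  have Beint: "integrable M (\<lambda>\<omega>. Bs i \<omega> * e a \<omega>)" if "i < n" for i a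
  proof (rule integrable_const_bound[of _ 1])
    show "AE \<omega> in M. norm (Bs i \<omega> * e a \<omega>) \<le> 1"
      using Zval(1)[OF that] e01 by (intro AE_I2) (force simp: abs_mult)
  qed (use Bm[OF that] in measurable)
  \<comment> \<open>Invertibility of the Gram matrix concerns the covariates only, so
    \<open>S\<close> is a finite union of configuration events; its measurability rests on
    this.\<close>
  have S_eq: "S = {\<omega> \<in> space M. good (\<lambda>i. As i \<omega>)}"
    unfolding S_def beta_LS_eq_beta_MP_iff good_def by (simp add: beta_LS_def)
  have good_restrict: "good (restrict a {..<n}) \<longleftrightarrow> good a" for a
    by (simp add: good_def gram_mat_def design_mat_restrict)
  have indS: "indicator S \<omega> = (\<Sum>a\<in>K. e a \<omega> * of_bool (good a))" if "\<omega> \<in> space M" for \<omega>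
    using that unfolding conf[OF that] good_restrict by (simp add: S_eq indicator_def)
  have Sm [measurable]: "S \<in> sets M"
  proof -
    have "(\<lambda>\<omega>. \<Sum>a\<in>K. e a \<omega> * of_bool (good a)) \<in> borel_measurable M" by measurable
    then have "{\<omega> \<in> space M. (\<Sum>a\<in>K. e a \<omega> * of_bool (good a)) = 1} \<in> sets M" by measurable
    also have "{\<omega> \<in> space M. (\<Sum>a\<in>K. e a \<omega> * of_bool (good a)) = 1} = S"
      by (auto simp: indS[symmetric] S_eq indicator_eq_1_iff)
    finally show ?thesis .
  qed
  have expand: "f a * beta_MP n p (\<lambda>i. Bs i \<omega>) a $ j = (\<Sum>i<n. f a * c a j i * Bs i \<omega>)"
    if "a \<in> K" "j < 2 ^ p" for f :: "_ \<Rightarrow> real" and a j \<omega>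
    by (simp add: beta_MP_index[OF K(2)[OF that(1)] that(2)] c_def sum_distrib_left mult.assoc)
  \<comment> \<open>The weight \<open>f\<close> is used twice: as the constant 1 for measurability
    of the estimator, and as the indicator of \<open>good\<close> for its integral over
    \<open>S\<close>.\<close>
  have dec: "f (restrict (\<lambda>i. As i \<omega>) {..<n}) * beta_MP n p (\<lambda>i. Bs i \<omega>) (\<lambda>i. As i \<omega>) $ j =
      (\<Sum>a\<in>K. \<Sum>i<n. (f a * c a j i) * (Bs i \<omega> * e a \<omega>))"
    if "\<omega> \<in> space M" "j < 2 ^ p" for f :: "_ \<Rightarrow> real" and j \<omega>
  proof -
    have "f (restrict (\<lambda>i. As i \<omega>) {..<n}) * beta_MP n p (\<lambda>i. Bs i \<omega>) (\<lambda>i. As i \<omega>) $ j =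
        (\<Sum>a\<in>K. e a \<omega> * (f a * beta_MP n p (\<lambda>i. Bs i \<omega>) a $ j))"
      unfolding conf[OF that(1)] beta_MP_restrict ..
    also have "\<dots> = (\<Sum>a\<in>K. e a \<omega> * (\<Sum>i<n. f a * c a j i * Bs i \<omega>))"
      by (intro sum.cong refl arg_cong2[where f="(*)"] expand that(2))
    finally show ?thesis by (simp add: sum_distrib_left mult_ac)
  qed
  have mean: "(\<integral>\<omega>. beta_MP n p (\<lambda>i. Bs i \<omega>) (\<lambda>i. As i \<omega>) $ j \<partial>uniform_measure M S) = \<beta> $ j"
    if j: "j < 2 ^ p" for j
  proof -
    let ?b = "\<lambda>\<omega>. beta_MP n p (\<lambda>i. Bs i \<omega>) (\<lambda>i. As i \<omega>) $ j"
    have bm: "?b \<in> borel_measurable M"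
    proof -
      have "(\<lambda>\<omega>. \<Sum>a\<in>K. \<Sum>i<n. (1 * c a j i) * (Bs i \<omega> * e a \<omega>)) \<in> borel_measurable M"
        using Bm by (intro borel_measurable_sum borel_measurable_times em) auto
      also have "?this \<longleftrightarrow> ?thesis"
        using dec[OF _ j, of _ "\<lambda>_. 1"] by (intro measurable_cong) simp
      finally show ?thesis .
    qed
    \<comment> \<open>Since \<open>S\<close> has positive measure, the quotient of extended reals
      can be moved inside \<open>ennreal\<close>.\<close>
    have "uniform_measure M S = density M (\<lambda>\<omega>. ennreal (indicator S \<omega> / measure M S))"
      unfolding uniform_measure_def emeasure_eq_measure using assms(7)
      by (intro arg_cong[where f="density M"] ext) (auto simp: divide_ennreal[symmetric] split: split_indicator)
    then have "(\<integral>\<omega>. ?b \<omega> \<partial>uniform_measure M S) =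
        (\<integral>\<omega>. indicator S \<omega> / measure M S * ?b \<omega> \<partial>M)"
      using bm by (simp add: integral_density)
    also have "\<dots> = (\<integral>\<omega>. (\<Sum>a\<in>K. \<Sum>i<n. (of_bool (good a) * c a j i) * (Bs i \<omega> * e a \<omega>)) \<partial>M) / measure M S"
      unfolding integral_divide_zero[symmetric]
    proof (rule Bochner_Integration.integral_cong[OF refl])
      fix \<omega> assume \<omega>: "\<omega> \<in> space M"
      have "indicator S \<omega> = (of_bool (good (restrict (\<lambda>i. As i \<omega>) {..<n})) :: real)"
        unfolding good_restrict using \<omega> by (simp add: S_eq indicator_def)
      then show "indicator S \<omega> / measure M S * ?b \<omega> =
          (\<Sum>a\<in>K. \<Sum>i<n. (of_bool (good a) * c a j i) * (Bs i \<omega> * e a \<omega>)) / measure M S"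
        using dec[OF \<omega> j, of "\<lambda>a. of_bool (good a)"] by simp
    qed
    also have "(\<integral>\<omega>. (\<Sum>a\<in>K. \<Sum>i<n. (of_bool (good a) * c a j i) * (Bs i \<omega> * e a \<omega>)) \<partial>M) =
        (\<Sum>a\<in>K. \<Sum>i<n. (of_bool (good a) * c a j i) * expectation (\<lambda>\<omega>. Bs i \<omega> * e a \<omega>))"
      using Beint
      by (subst Bochner_Integration.integral_sum, force intro!: Bochner_Integration.integrable_sum,
          intro sum.cong refl, subst Bochner_Integration.integral_sum) auto
    also have "\<dots> = (\<Sum>a\<in>K. \<beta> $ j * (of_bool (good a) * expectation (e a)))"
    proof (rule sum.cong[OF refl])
      fix a assume a: "a \<in> K"
      \<comment> \<open>By \<open>sample_moment\<close> each response is replaced by its conditional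
        mean, with the probability of the configuration as a common factor.\<close>
      have "(\<Sum>i<n. (of_bool (good a) * c a j i) * expectation (\<lambda>\<omega>. Bs i \<omega> * e a \<omega>)) =
          of_bool (good a) * expectation (e a) * (\<Sum>i<n. c a j i * (\<beta> \<bullet> tensor_vec (a i)))"
        using sample_moment[OF B A indep dist reg K(2)[OF a], folded e_def]
        by (simp add: sum_distrib_left mult_ac)
      also have "(\<Sum>i<n. c a j i * (\<beta> \<bullet> tensor_vec (a i))) =
          beta_MP n p (\<lambda>i. \<beta> \<bullet> tensor_vec (a i)) a $ j"
        unfolding c_def by (rule beta_MP_index[OF K(2)[OF a] j, symmetric])
      \<comment> \<open>For \<open>good a\<close> the estimator reproduces \<beta> from the
        conditional means; otherwise both sides vanish.\<close>
      finally show "(\<Sum>i<n. (of_bool (good a) * c a j i) * expectation (\<lambda>\<omega>. Bs i \<omega> * e a \<omega>)) =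
          \<beta> $ j * (of_bool (good a) * expectation (e a))"
        using beta_MP_reproduces[OF K(2)[OF a] _ \<beta>] by (cases "good a") (auto simp: good_def)
    qed
    also have "\<dots> = \<beta> $ j * (\<integral>\<omega>. (\<Sum>a\<in>K. e a \<omega> * of_bool (good a)) \<partial>M)"
      using eint by (simp add: Bochner_Integration.integral_sum sum_distrib_left mult_ac)
    \<comment> \<open>The good configurations together make up \<open>S\<close>, whose probability
      cancels the normalization.\<close>
    also have "(\<integral>\<omega>. (\<Sum>a\<in>K. e a \<omega> * of_bool (good a)) \<partial>M) = (\<integral>\<omega>. indicator S \<omega> \<partial>M)"
      using indS by (intro Bochner_Integration.integral_cong) auto
    also have "\<dots> = measure M S" using Sm by simp
    finally show ?thesis using assms(7) by simp
  qed
  have mle: "is_arg_max (likelihood n (\<lambda>i. Bs i \<omega>) (\<lambda>i. As i \<omega>) q) (\<lambda>b. b \<in> beta_space p)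
      (beta_MP n p (\<lambda>i. Bs i \<omega>) (\<lambda>i. As i \<omega>))" if "\<omega> \<in> space M" "q \<in> row_probs p" for \<omega> q
  proof -
    have a: "\<forall>i<n. As i \<omega> \<in> ?V" and b: "\<forall>i<n. Bs i \<omega> \<in> {-1, 1}"
      using Zval that(1) by auto
    show ?thesis
      unfolding is_arg_max_linorder
      using beta_MP_in_beta_space[OF a b] likelihood_le_beta_MP[OF a b that(2)] by auto
  qed
  have "vec (2 ^ p) (\<lambda>j. \<integral>\<omega>. beta_MP n p (\<lambda>i. Bs i \<omega>) (\<lambda>i. As i \<omega>) $ j \<partial>uniform_measure M S) = \<beta>"
    using \<beta> mean by (intro eq_vecI) auto
  then show ?thesis using mle by blast
qed

end
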